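(* Let $\mathcal C$ be a segment (of finite length) of an unbounded geodesic on the torus $\mathbb T^2$. Then there are arbitrarily large eigenvalues $\lambda^2$ of $-\Delta$ on $\mathbb T^2$ for which there exists a real-valued eigenfunction $F$, $F\neq 0$, $-\Delta F=\lambda^2F$, such that $F$ has no zeros on $\mathcal C$, that is, $N_{F,\mathcal C}=0$.
   Context: $\mathbb T^2=\mathbb R^2/2\pi\mathbb Z^2$ is the standard flat torus and $\Delta$ its Laplacian. An unbounded geodesic is the image in $\mathbb T^2$ of a straight line in $\mathbb R^2$ of irrational slope (a geodesic that is not closed). $N_{F,\mathcal C}=\#(\{x: F(x)=0\}\cap\mathcal C)$ is the number of zeros of $F$ on $\mathcal C$. *)

theory Defs
  imports "HOL-Analysis.Analysis" "HOL-Library.Extended_Nat"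
begin

definition lattice_equiv :: "real^2 \<Rightarrow> real^2 \<Rightarrow> bool" where
  "lattice_equiv x y \<longleftrightarrow> (\<forall>i. \<exists>m::int. x $ i - y $ i = 2 * pi * of_int m)"

lemma equivp_lattice_equiv: "equivp lattice_equiv"
proof (rule equivpI)
  show "reflp lattice_equiv"
    by (auto simp: reflp_def lattice_equiv_def intro: exI[of _ 0])
  show "symp lattice_equiv"
  proof (rule sympI)
    fix x y :: "real^2"
    assume xy: "lattice_equiv x y"
    show "lattice_equiv y x"
      unfolding lattice_equiv_def
    proof
      fix i
      obtain m :: int where "x $ i - y $ i = 2 * pi * of_int m"
        using xy unfolding lattice_equiv_def by blast
      then have "y $ i - x $ i = 2 * pi * of_int (- m)" by simp
      then show "\<exists>m::int. y $ i - x $ i = 2 * pi * of_int m" by blast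
    qed
  qed
  show "transp lattice_equiv"
  proof (rule transpI)
    fix x y z :: "real^2"
    assume xy: "lattice_equiv x y" and yz: "lattice_equiv y z"
    show "lattice_equiv x z"
      unfolding lattice_equiv_def
    proof
      fix i
      obtain m :: int where m: "x $ i - y $ i = 2 * pi * of_int m"
        using xy unfolding lattice_equiv_def by blast
      obtain n :: int where n: "y $ i - z $ i = 2 * pi * of_int n"
        using yz unfolding lattice_equiv_def by blast
      have "x $ i - z $ i = 2 * pi * of_int (m + n)"
        using m n by (simp add: algebra_simps)
      then show "\<exists>m::int. x $ i - z $ i = 2 * pi * of_int m" by blast
    qed
  qed
qed

quotient_type torus = "real^2" / lattice_equiv
  by (rule equivp_lattice_equiv)

abbreviation torus_proj :: "real^2 \<Rightarrow> torus" where
  "torus_proj \<equiv> abs_torus"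

definition partial :: "2 \<Rightarrow> (real^2 \<Rightarrow> real) \<Rightarrow> real^2 \<Rightarrow> real" where
  "partial i f x = deriv (\<lambda>t. f (x + t *\<^sub>R axis i 1)) 0"

definition laplacian :: "(real^2 \<Rightarrow> real) \<Rightarrow> real^2 \<Rightarrow> real" where
  "laplacian f x = (\<Sum>i\<in>UNIV. partial i (partial i f) x)"

primrec C_k :: "nat \<Rightarrow> (real^2 \<Rightarrow> real) \<Rightarrow> bool" where
  "C_k 0 f \<longleftrightarrow> continuous_on UNIV f"
| "C_k (Suc k) f \<longleftrightarrow> f differentiable_on UNIV \<and> (\<forall>i. C_k k (partial i f))"

definition torus_smooth :: "(torus \<Rightarrow> real) \<Rightarrow> bool" where
  "torus_smooth F \<longleftrightarrow> (\<forall>k. C_k k (F \<circ> torus_proj))"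

text \<open>
  The projection is a local isometry for the flat metric, so the Laplacian of the torus is the
  Euclidean one applied to the periodic lift. The representative chosen by \<open>rep_torus\<close> is
  irrelevant, see \<open>torus_laplacian_proj\<close> below.
\<close>

definition torus_laplacian :: "(torus \<Rightarrow> real) \<Rightarrow> torus \<Rightarrow> real" where
  "torus_laplacian F p = laplacian (F \<circ> torus_proj) (rep_torus p)"

lemma torus_proj_eq_iff: "torus_proj x = torus_proj y \<longleftrightarrow> lattice_equiv x y"
  by (rule torus.abs_eq_iff)

lemma laplacian_periodic:
  assumes "\<And>x. f (x + v) = f x"
  shows "laplacian f (x + v) = laplacian f x"
proof -
  have step: "partial i g (y + v) = partial i g y" if "\<And>x. g (x + v) = g x" for g i y
    using that[of "y + _ *\<^sub>R axis i 1"] by (simp add: partial_def add.assoc add.commute[of v])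
  show ?thesis
    by (simp add: laplacian_def step assms)
qed

lemma torus_laplacian_proj:
  "torus_laplacian F (torus_proj x) = laplacian (F \<circ> torus_proj) x"
proof -
  let ?r = "rep_torus (torus_proj x)"
  have eq: "lattice_equiv ?r x"
    using Quotient_rep_abs[OF Quotient_torus] equivp_reflp[OF equivp_lattice_equiv] by blast
  have "(F \<circ> torus_proj) (y + (?r - x)) = (F \<circ> torus_proj) y" for y
  proof -
    have "lattice_equiv (y + (?r - x)) y"
      using eq by (simp add: lattice_equiv_def)
    then show ?thesis
      by (simp add: torus_proj_eq_iff[symmetric])
  qed
  from laplacian_periodic[of "F \<circ> torus_proj" "?r - x" x, OF this]
  show ?thesis
    by (simp add: torus_laplacian_def)
qed

definition torus_eigenfunction :: "real \<Rightarrow> (torus \<Rightarrow> real) \<Rightarrow> bool" where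
  "torus_eigenfunction \<mu> F \<longleftrightarrow>
     torus_smooth F \<and> F \<noteq> (\<lambda>p. 0) \<and> (\<forall>p. - torus_laplacian F p = \<mu> * F p)"

definition irrational_line :: "(real^2) set \<Rightarrow> bool" where
  "irrational_line L \<longleftrightarrow> (\<exists>s c. s \<notin> \<rat> \<and> L = {x. x $ 2 = s * x $ 1 + c})"

text \<open>
  A connected bounded subset of a line is exactly a segment of finite length, with or without
  its endpoints.
\<close>

definition unbounded_geodesic_segment :: "torus set \<Rightarrow> bool" where
  "unbounded_geodesic_segment C \<longleftrightarrow>
     (\<exists>L S. irrational_line L \<and> S \<subseteq> L \<and> connected S \<and> bounded S \<and> C = torus_proj ` S)"

text \<open>The count takes values in \<open>enat\<close> because \<open>card\<close> is \<open>0\<close> on infinite sets.\<close>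

definition zero_count :: "(torus \<Rightarrow> real) \<Rightarrow> torus set \<Rightarrow> enat" where
  "zero_count F C = (let Z = {p. F p = 0} \<inter> C in if finite Z then enat (card Z) else \<infinity>)"

end

theory Submission
  imports Defs
begin

text \<open>
  A plane wave \<open>cos (v \<bullet> x + \<phi>)\<close> with nonzero integral frequency \<open>v = (p, q)\<close> descends to the torus
  and is an eigenfunction with eigenvalue \<open>p\<^sup>2 + q\<^sup>2\<close>. Its zero set consists of lines orthogonal to \<open>v\<close>. If
  \<open>v\<close> is almost orthogonal to the geodesic, then the wave hardly oscillates along the segment:
  on the line \<open>x\<^sub>2 = s x\<^sub>1 + c\<close> the phase is \<open>(p + q s) x\<^sub>1 + (q c + \<phi>)\<close>. Choosing \<open>\<phi> = - q c\<close> centres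
  it, and the cosine is positive as soon as \<open>\<bar>p + q s\<bar> \<bar>x\<^sub>1\<bar> < \<pi>/2\<close> on the segment. Dirichlet's
  approximation theorem supplies such pairs with \<open>q\<close> as large as desired
  (\<open>large_denominator_approx\<close>).
\<close>

lemma partial_plane_wave:
  "partial i (\<lambda>x. A * cos (v \<bullet> x + \<phi>)) = (\<lambda>x. (A * v $ i) * cos (v \<bullet> x + (\<phi> + pi / 2)))"
proof
  fix x :: "real^2"
  have "((\<lambda>t. A * cos (v \<bullet> (x + t *\<^sub>R axis i 1) + \<phi>)) has_field_derivative
          - (A * v $ i) * sin (v \<bullet> x + \<phi>)) (at 0)"
    by (auto intro!: derivative_eq_intros simp: inner_add_right inner_axis)
  then have "partial i (\<lambda>x. A * cos (v \<bullet> x + \<phi>)) x = - (A * v $ i) * sin (v \<bullet> x + \<phi>)"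
    unfolding partial_def by (rule DERIV_imp_deriv)
  also have "\<dots> = (A * v $ i) * cos (v \<bullet> x + (\<phi> + pi / 2))"
    by (simp add: cos_add sin_add algebra_simps)
  finally show "partial i (\<lambda>x. A * cos (v \<bullet> x + \<phi>)) x
      = (A * v $ i) * cos (v \<bullet> x + (\<phi> + pi / 2))" .
qed

text \<open>
  Amplitude and phase are arbitrary because the partial derivatives are again plane waves, with
  another amplitude and the phase shifted by a quarter period.
\<close>

lemma C_k_plane_wave: "C_k k (\<lambda>x. A * cos (v \<bullet> x + \<phi>))"
proof (induction k arbitrary: A \<phi>)
  case 0
  show ?case by (auto intro!: continuous_intros)
next
  case (Suc k)
  have "(\<lambda>x. A * cos (v \<bullet> x + \<phi>)) differentiable at x" for x
    unfolding differentiable_def by (rule exI) (auto intro!: derivative_eq_intros)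
  then show ?case
    by (auto simp: partial_plane_wave Suc differentiable_on_def
        intro: differentiable_at_withinI)
qed

lemma laplacian_plane_wave:
  "laplacian (\<lambda>x. cos (v \<bullet> x + \<phi>)) x = - (v \<bullet> v) * cos (v \<bullet> x + \<phi>)"
proof -
  have second: "partial i (partial i (\<lambda>x. cos (v \<bullet> x + \<phi>))) x = - (v $ i)\<^sup>2 * cos (v \<bullet> x + \<phi>)" for i
  proof -
    have shift: "cos (v \<bullet> x + (pi + \<phi>)) = - cos (v \<bullet> x + \<phi>)"
      using cos_periodic_pi[of "v \<bullet> x + \<phi>"] by (simp add: algebra_simps)
    show ?thesis
      using partial_plane_wave[of i 1 v \<phi>] partial_plane_wave[of i "v $ i" v "\<phi> + pi / 2"]
      by (simp add: shift power2_eq_square)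
  qed
  show ?thesis
    unfolding laplacian_def second by (simp add: inner_vec_def sum_2 power2_eq_square ring_distribs)
qed

lemma plane_wave_lattice_invariant:
  fixes v :: "real^2"
  assumes v: "\<And>i. v $ i \<in> \<int>" and xy: "lattice_equiv x y"
  shows "cos (v \<bullet> x + \<phi>) = cos (v \<bullet> y + \<phi>)"
proof -
  obtain m :: "2 \<Rightarrow> int" where m: "\<And>i. x $ i - y $ i = 2 * pi * of_int (m i)"
    using xy unfolding lattice_equiv_def by metis
  have "(\<Sum>i\<in>UNIV. v $ i * of_int (m i)) \<in> \<int>"
    using v by (intro Ints_sum Ints_mult) auto
  then obtain N :: int where N: "(\<Sum>i\<in>UNIV. v $ i * of_int (m i)) = of_int N"
    by (auto elim: Ints_cases)
  have "v \<bullet> x - v \<bullet> y = (\<Sum>i\<in>UNIV. v $ i * (x $ i - y $ i))"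
    by (simp add: inner_vec_def sum_subtractf algebra_simps)
  also have "\<dots> = 2 * pi * of_int N"
    by (simp add: m N[symmetric] sum_distrib_left algebra_simps)
  finally have "v \<bullet> x + \<phi> = v \<bullet> y + \<phi> + 2 * pi * of_int N" by simp
  then show ?thesis
    by (simp only: cos_add[of _ "2 * pi * of_int N"] cos_int_2pin
        sin_int_2pin mult_1_right mult_zero_right diff_zero)
qed

lemma torus_eigenfunction_plane_wave:
  fixes v :: "real^2"
  assumes v: "\<And>i. v $ i \<in> \<int>" and "v \<noteq> 0"
  obtains F where "torus_eigenfunction (v \<bullet> v) F" "\<And>x. F (torus_proj x) = cos (v \<bullet> x + \<phi>)"
proof
  define F where "F = (\<lambda>p. cos (v \<bullet> rep_torus p + \<phi>))"
  show F: "F (torus_proj x) = cos (v \<bullet> x + \<phi>)" for x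
  proof -
    have "lattice_equiv (rep_torus (torus_proj x)) x"
      using Quotient_rep_abs[OF Quotient_torus] equivp_reflp[OF equivp_lattice_equiv] by blast
    then show ?thesis
      unfolding F_def by (rule plane_wave_lattice_invariant[OF v])
  qed
  then have lift: "F \<circ> torus_proj = (\<lambda>x. cos (v \<bullet> x + \<phi>))" by auto
  have smooth: "torus_smooth F"
    unfolding torus_smooth_def lift using C_k_plane_wave[of _ 1] by simp
  have nonzero: "F \<noteq> (\<lambda>p. 0)"
  proof
    assume zero: "F = (\<lambda>p. 0)"
    \<comment> \<open>a point where the phase vanishes\<close>
    have "F (torus_proj ((- \<phi> / (v \<bullet> v)) *\<^sub>R v)) = 1"
      using \<open>v \<noteq> 0\<close> by (simp add: F)
    then show False by (simp add: zero)
  qed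
  show "torus_eigenfunction (v \<bullet> v) F"
    unfolding torus_eigenfunction_def
  proof (intro conjI allI smooth nonzero)
    fix p
    obtain x where "p = torus_proj x" by (metis Quotient_abs_rep[OF Quotient_torus])
    then show "- torus_laplacian F p = v \<bullet> v * F p"
      by (simp add: torus_laplacian_proj lift laplacian_plane_wave F)
  qed
qed

text \<open>
  Dirichlet's theorem gives integers with a small \<open>\<bar>q s - p\<bar>\<close> without a lower bound for \<open>q\<close>. Multiplying
  \<open>p\<close> and \<open>q\<close> by \<open>M\<close> forces \<open>q \<ge> M\<close> and enlarges the error only by the factor \<open>M\<close>, which the bound
  \<open>1/N\<close> absorbs once \<open>N > M/e\<close>.
\<close>

lemma large_denominator_approx:
  fixes s e :: real and M :: nat
  assumes "e > 0" "M > 0"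
  obtains p q :: int where "q \<ge> int M" "\<bar>p + q * s\<bar> < e"
proof -
  obtain N :: nat where N: "real M / e < real N"
    using reals_Archimedean2 by blast
  have "0 < real M / e" using assms by simp
  then have "N > 0" using N by (cases N) auto
  then obtain h k where k: "0 < k" "k \<le> int N" and h: "\<bar>of_int k * s - of_int h\<bar> < 1 / real N"
    by (rule Dirichlet_approx)
  show thesis
  proof
    show "int M * k \<ge> int M" using k by (simp add: mult_le_cancel_left1)
    have "\<bar>real_of_int (- (int M * h)) + real_of_int (int M * k) * s\<bar>
        = \<bar>real M * (of_int k * s - of_int h)\<bar>"
      by (simp add: algebra_simps)
    also have "\<dots> = real M * \<bar>of_int k * s - of_int h\<bar>"
      by (simp add: abs_mult)
    also have "\<dots> \<le> real M * (1 / real N)"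
      using h by (intro mult_left_mono) auto
    also have "\<dots> < e"
      using N \<open>N > 0\<close> \<open>e > 0\<close> by (simp add: field_simps)
    finally show "\<bar>real_of_int (- (int M * h)) + real_of_int (int M * k) * s\<bar> < e" .
  qed
qed

theorem mainTheorem5:
  fixes C :: "torus set"
  assumes "unbounded_geodesic_segment C"
  shows "\<forall>K::real. \<exists>lam::real. lam\<^sup>2 > K \<and>
           (\<exists>F. torus_eigenfunction (lam\<^sup>2) F \<and> zero_count F C = 0)"
proof
  fix K :: real
  obtain L S where "irrational_line L" "S \<subseteq> L" and S: "bounded S" and C: "C = torus_proj ` S"
    using assms unfolding unbounded_geodesic_segment_def by blast
  then obtain s c where line: "\<And>x. x \<in> S \<Longrightarrow> x $ 2 = s * x $ 1 + c"
    unfolding irrational_line_def by blast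
  obtain T where T: "T > 0" "\<And>x. x \<in> S \<Longrightarrow> norm x \<le> T"
    using S by (auto simp: bounded_pos)
  obtain M :: nat where M: "max K 1 < real M"
    using reals_Archimedean2 by blast
  then have "M > 0" by (cases M) auto
  obtain p q :: int where q: "q \<ge> int M" and pq: "\<bar>p + q * s\<bar> < pi / 2 / T"
    by (rule large_denominator_approx[of "pi / 2 / T" M s]) (use T(1) \<open>M > 0\<close> in auto)
  define v :: "real^2" where "v = vector [of_int p, of_int q]"
  have v12: "v $ 1 = of_int p" "v $ 2 = of_int q" by (simp_all add: v_def)
  then have v_int: "v $ i \<in> \<int>" for i
    using exhaust_2[of i] by auto
  have "v \<noteq> 0"
    using v12(2) q \<open>M > 0\<close> by auto
  then obtain F where eig: "torus_eigenfunction (v \<bullet> v) F"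
    and F: "\<And>x. F (torus_proj x) = cos (v \<bullet> x + (- of_int q * c))"
    using torus_eigenfunction_plane_wave[of v "- of_int q * c"] v_int by blast
  have "F (torus_proj x) > 0" if "x \<in> S" for x
  proof -
    have "\<bar>x $ 1\<bar> \<le> T"
      using component_le_norm_cart[of x 1] T(2)[OF that] by linarith
    then have "\<bar>p + q * s\<bar> * \<bar>x $ 1\<bar> \<le> \<bar>p + q * s\<bar> * T"
      by (intro mult_left_mono) auto
    also have "\<dots> < pi / 2"
      using pq T(1) by (simp add: field_simps)
    finally have small: "\<bar>(p + q * s) * x $ 1\<bar> < pi / 2"
      by (simp add: abs_mult)
    have "v \<bullet> x + (- of_int q * c) = (p + q * s) * x $ 1"
      by (simp add: inner_vec_def sum_2 v12 line[OF that] algebra_simps)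
    then show ?thesis
      using small by (simp only: F) (auto intro!: cos_gt_zero_pi)
  qed
  then have "{p. F p = 0} \<inter> C = {}"
    using C by force
  then have "zero_count F C = 0"
    by (simp add: zero_count_def zero_enat_def)
  moreover have "(norm v)\<^sup>2 > K"
  proof -
    have "K < real M" "1 \<le> real M" "real M \<le> q" using M q by linarith+
    then have "K < real_of_int q * real_of_int q"
      using mult_mono[of 1 "real_of_int q" "real_of_int q" "real_of_int q"] by linarith
    also have "\<dots> \<le> (norm v)\<^sup>2"
      by (simp add: dot_square_norm[symmetric] inner_vec_def sum_2 v12)
    finally show ?thesis .
  qed
  ultimately show "\<exists>lam::real. lam\<^sup>2 > K \<and> (\<exists>F. torus_eigenfunction (lam\<^sup>2) F \<and> zero_count F C = 0)"
    using eig by (intro exI[of _ "norm v"]) (auto simp: dot_square_norm)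
qed

end
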